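(* Let $\mathcal{J}$ be a first-order structure, let $\mathit{infer}$ be any mapping from states to sets of states satisfying conditions (1)–(5) listed in the context, and let $[\![\cdot]\!]$ be the semantics determined by $\mathit{infer}$ as defined in the context. Let a state $\langle \mathcal{C};\theta\rangle$ (with $\mathcal{C}$ a finite set of formulas and $\theta$ a substitution) and a formula $\phi$ be given. Then: 1. If $\langle \mathcal{C}';\theta'\rangle\in\langle \mathcal{C};\theta\rangle[\![\phi]\!]$, then $\langle \mathcal{C}';\theta'\rangle\models_{\mathcal{J}}\phi$. 2. If $\mathrm{cons}^+(\langle \mathcal{C};\theta\rangle[\![\phi]\!])=\emptyset$, then $\langle \mathcal{C};\theta\rangle\models_{\mathcal{J}}\neg\phi$.
   Context: Formulas are first-order formulas built from atomic formulas using $\vee$, $\wedge$, $\neg$ and $\exists$, interpreted in a fixed structure $\mathcal{J}$ (based on an algebra for the term language); $\bot$ denotes a formula that is always false. A substitution $\theta$ maps variables to terms, with $x\theta\neq x$ for only finitely many $x$; $\epsilon$ is the empty substitution. States: the set of states consists of a special state $\mathbf{error}$ and all pairs $\langle \mathcal{C};\theta\rangle$ where $\mathcal{C}$ (the constraint store) is a finite set of formulas and $\theta$ a substitution. Write $\langle \mathcal{C};\theta\rangle\models_{\mathcal{J}}\phi$ for $\mathcal{C}\theta\models_{\mathcal{J}}\phi\theta$ (every assignment of elements of $\mathcal{J}$ to variables satisfying all formulas of $\mathcal{C}\theta$ satisfies $\phi\theta$); in particular $\langle\emptyset;\theta\rangle\models_{\mathcal{J}}\phi$ iff $\models_{\mathcal{J}}\phi\theta$.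 A state $\sigma$ is $\mathcal{J}$-consistent if $\sigma\neq\mathbf{error}$ and $\sigma\not\models_{\mathcal{J}}\bot$; $\mathcal{J}$-inconsistent if $\sigma\neq\mathbf{error}$ and $\sigma\models_{\mathcal{J}}\bot$. For a set of states $\Sigma$: $\mathrm{cons}(\Sigma)$ is the set of $\mathcal{J}$-consistent members, and $\mathrm{cons}^+(\Sigma)$ is the set of members that are not $\mathcal{J}$-inconsistent (so $\mathbf{error}$ belongs to $\mathrm{cons}^+(\Sigma)$ if it belongs to $\Sigma$). Conditions on $\mathit{infer}$ (a map from states to sets of states): (1) Equivalence: if $\langle \mathcal{C}';\theta'\rangle\in\mathit{infer}\langle \mathcal{C};\theta\rangle$ then for every formula $\phi$, $\langle \mathcal{C};\theta\rangle\models_{\mathcal{J}}\phi$ iff $\langle \mathcal{C}';\theta'\rangle\models_{\mathcal{J}}\phi$. (2) Renaming: if $\langle \mathcal{C}';\theta'\rangle\in\mathit{infer}\langle \mathcal{C};\theta\rangle$, then also $\langle \mathcal{C}'_v;\theta'_v\rangle\in\mathit{infer}\langle \mathcal{C};\theta\rangle$, where $\langle \mathcal{C}'_v;\theta'_v\rangle$ is obtained from $\langle \mathcal{C}';\theta'\rangle$ by replacing all occurrences of $u$ by $v$, for any variable $u$ fresh w.r.t. $\langle \mathcal{C};\theta\rangle$ and any $v$ fresh w.r.t. both $\langle \mathcal{C};\theta\rangle$ and $\langle \mathcal{C}';\theta'\rangle$. (3) Inconsistency: if $\mathit{infer}\langle \mathcal{C};\theta\rangle=\emptyset$ then $\langle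 \mathcal{C};\theta\rangle\models_{\mathcal{J}}\bot$. (4) Error: $\mathit{infer}\,\mathbf{error}=\{\mathbf{error}\}$. (5) Identity: $\mathit{infer}\langle\emptyset;\theta\rangle=\{\langle\emptyset;\theta\rangle\}$. Dropping: for a variable $u$ and substitution $\theta$, $\mathit{DROP}_u(\theta)$ is the substitution with $u\,\mathit{DROP}_u(\theta)=u$ and $x\,\mathit{DROP}_u(\theta)=x\theta$ for $x\neq u$. For a store $\mathcal{C}$, $\mathcal{C}(u)$ is the set of formulas of $\mathcal{C}$ in which $u$ occurs free. Given $\eta$, let $\mathbf{y}=\mathbf{y}\eta$ denote the conjunction of the equations $y=y\eta$ over all variables $y\neq u$ such that $u$ occurs in $y\eta$. Then $\mathrm{drop}_u\langle \mathcal{C};\eta\rangle=\langle \mathcal{C};\mathit{DROP}_u(\eta)\rangle$ if $\mathcal{C}(u)=\emptyset$; otherwise $\mathrm{drop}_u\langle \mathcal{C};\eta\rangle=\langle (\mathcal{C}-\mathcal{C}(u))\cup\{\exists u\,(u=u\eta\wedge \mathbf{y}=\mathbf{y}\eta\wedge\bigwedge\mathcal{C}(u))\};\mathit{DROP}_u(\eta)\rangle$; and $\mathrm{drop}_u\,\mathbf{error}=\mathbf{error}$. Semantics: for each formula $\phi$, $[\![\phi]\!]$ maps a state to a set of states (written postfix; for a set $\Sigma$, $\Sigma[\![\phi]\!]=\bigcup_{\sigma\in\Sigma}\sigma[\![\phi]\!]$): - $\langle \mathcal{C};\theta\rangle[\![A]\!]=\mathit{infer}\langle \mathcal{C}\cup\{A\};\theta\rangle$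 for atomic $A$; - $\langle \mathcal{C};\theta\rangle[\![\phi_1\vee\phi_2]\!]=\langle \mathcal{C};\theta\rangle[\![\phi_1]\!]\cup\langle \mathcal{C};\theta\rangle[\![\phi_2]\!]$; - $\langle \mathcal{C};\theta\rangle[\![\phi_1\wedge\phi_2]\!]=(\langle \mathcal{C};\theta\rangle[\![\phi_1]\!])[\![\phi_2]\!]$; - $\langle \mathcal{C};\theta\rangle[\![\neg\phi]\!]$ equals $\mathit{infer}\langle \mathcal{C};\theta\rangle$ if $\mathrm{cons}^+(\langle \mathcal{C};\theta\rangle[\![\phi]\!])=\emptyset$; equals $\emptyset$ if $\mathrm{cons}(\langle \mathcal{C};\theta\rangle[\![\phi]\!])$ contains some state equivalent to $\langle \mathcal{C};\theta\rangle$ (i.e. satisfying the same formulas); and equals $\mathit{infer}\langle \mathcal{C}\cup\{\neg\phi\};\theta\rangle$ otherwise; - $\langle \mathcal{C};\theta\rangle[\![\exists x\,\phi]\!]=\bigcup_{\sigma}\mathit{infer}(\mathrm{drop}_u(\sigma))$, where $u$ is a fresh variable and $\sigma$ ranges over $\mathrm{cons}^+(\langle \mathcal{C};\theta\rangle[\![\phi\{x/u\}]\!])$; - $\mathbf{error}[\![\phi]\!]=\{\mathbf{error}\}$ for all $\phi$.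
   Formalization: The claim is proved for an idempotent initial substitution θ and for infer mapping states with idempotent substitutions to such states; without this part 2 can fail, since drop_u is wrong when u is bound to a term containing u, such as s(u). *)

theory Defs
  imports Main "HOL-Library.Infinite_Typeclass"
begin

section \<open>First-order terms and formulas\<close>

text \<open>Symbols are unranked: a symbol applied to argument lists of different lengths
  behaves as several unrelated symbols.\<close>

datatype ('f, 'v) trm = Var 'v | Fun 'f "('f, 'v) trm list"

datatype ('f, 'p, 'v) fm =
    Rel 'p "('f, 'v) trm list"
  | Eq "('f, 'v) trm" "('f, 'v) trm"
  | Or "('f, 'p, 'v) fm" "('f, 'p, 'v) fm"
  | And "('f, 'p, 'v) fm" "('f, 'p, 'v) fm"
  | Neg "('f, 'p, 'v) fm"
  | Ex 'v "('f, 'p, 'v) fm"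

primrec vars_trm :: "('f, 'v) trm \<Rightarrow> 'v set" where
  "vars_trm (Var x) = {x}"
| "vars_trm (Fun f ts) = \<Union> (set (map vars_trm ts))"

primrec free_vars :: "('f, 'p, 'v) fm \<Rightarrow> 'v set" where
  "free_vars (Rel p ts) = \<Union> (set (map vars_trm ts))"
| "free_vars (Eq s t) = vars_trm s \<union> vars_trm t"
| "free_vars (Or \<phi> \<psi>) = free_vars \<phi> \<union> free_vars \<psi>"
| "free_vars (And \<phi> \<psi>) = free_vars \<phi> \<union> free_vars \<psi>"
| "free_vars (Neg \<phi>) = free_vars \<phi>"
| "free_vars (Ex x \<phi>) = free_vars \<phi> - {x}"

text \<open>All variables occurring in a formula, free or bound.\<close>

primrec vars_fm :: "('f, 'p, 'v) fm \<Rightarrow> 'v set" where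
  "vars_fm (Rel p ts) = \<Union> (set (map vars_trm ts))"
| "vars_fm (Eq s t) = vars_trm s \<union> vars_trm t"
| "vars_fm (Or \<phi> \<psi>) = vars_fm \<phi> \<union> vars_fm \<psi>"
| "vars_fm (And \<phi> \<psi>) = vars_fm \<phi> \<union> vars_fm \<psi>"
| "vars_fm (Neg \<phi>) = vars_fm \<phi>"
| "vars_fm (Ex x \<phi>) = insert x (vars_fm \<phi>)"

text \<open>A formula that is always false; which variable it binds is immaterial.\<close>

definition Falsum :: "('f, 'p, 'v) fm" where
  "Falsum = Ex undefined (Neg (Eq (Var undefined) (Var undefined)))"

text \<open>Conjunction of a nonempty list; the empty list is only there for totality.\<close>

fun conj_list :: "('f, 'p, 'v) fm list \<Rightarrow> ('f, 'p, 'v) fm" where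
  "conj_list [] = Neg Falsum"
| "conj_list [\<phi>] = \<phi>"
| "conj_list (\<phi> # \<psi> # \<phi>s) = And \<phi> (conj_list (\<psi> # \<phi>s))"

text \<open>An arbitrary enumeration of a finite set, used to form its conjunction.\<close>

definition enum_set :: "'a set \<Rightarrow> 'a list" where
  "enum_set A = (SOME xs. set xs = A \<and> distinct xs)"


section \<open>Substitutions\<close>

type_synonym ('f, 'v) subst = "'v \<Rightarrow> ('f, 'v) trm"

definition subst_dom :: "('f, 'v) subst \<Rightarrow> 'v set" where
  "subst_dom \<theta> = {x. \<theta> x \<noteq> Var x}"

definition vars_subst :: "('f, 'v) subst \<Rightarrow> 'v set" where
  "vars_subst \<theta> = subst_dom \<theta> \<union> (\<Union>x\<in>subst_dom \<theta>. vars_trm (\<theta> x))"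

primrec subst_trm :: "('f, 'v) trm \<Rightarrow> ('f, 'v) subst \<Rightarrow> ('f, 'v) trm" where
  "subst_trm (Var x) \<theta> = \<theta> x"
| "subst_trm (Fun f ts) \<theta> = Fun f (map (\<lambda>t. subst_trm t \<theta>) ts)"

text \<open>Capture-avoiding: a bound variable is renamed exactly when it would capture a variable.\<close>

primrec subst_fm :: "('f, 'p, 'v) fm \<Rightarrow> ('f, 'v) subst \<Rightarrow> ('f, 'p, 'v) fm" where
  "subst_fm (Rel p ts) \<theta> = Rel p (map (\<lambda>t. subst_trm t \<theta>) ts)"
| "subst_fm (Eq s t) \<theta> = Eq (subst_trm s \<theta>) (subst_trm t \<theta>)"
| "subst_fm (Or \<phi> \<psi>) \<theta> = Or (subst_fm \<phi> \<theta>) (subst_fm \<psi> \<theta>)"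
| "subst_fm (And \<phi> \<psi>) \<theta> = And (subst_fm \<phi> \<theta>) (subst_fm \<psi> \<theta>)"
| "subst_fm (Neg \<phi>) \<theta> = Neg (subst_fm \<phi> \<theta>)"
| "subst_fm (Ex x \<phi>) \<theta> =
     (let W = (\<Union>y\<in>free_vars \<phi> - {x}. vars_trm (\<theta> y));
          z = (if x \<in> W then SOME z. z \<notin> W \<union> vars_fm \<phi> else x)
      in Ex z (subst_fm \<phi> (\<theta>(x := Var z))))"

definition idempotent :: "('f, 'v) subst \<Rightarrow> bool" where
  "idempotent \<theta> \<longleftrightarrow> (\<forall>x. subst_trm (\<theta> x) \<theta> = \<theta> x)"


section \<open>Structures and satisfaction\<close>

record ('f, 'p, 'a) struct =
  fun_interp :: "'f \<Rightarrow> 'a list \<Rightarrow> 'a"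
  rel_interp :: "'p \<Rightarrow> 'a list \<Rightarrow> bool"

primrec eval_trm :: "('f, 'p, 'a) struct \<Rightarrow> ('v \<Rightarrow> 'a) \<Rightarrow> ('f, 'v) trm \<Rightarrow> 'a" where
  "eval_trm J \<alpha> (Var x) = \<alpha> x"
| "eval_trm J \<alpha> (Fun f ts) = fun_interp J f (map (eval_trm J \<alpha>) ts)"

primrec sat :: "('f, 'p, 'a) struct \<Rightarrow> ('v \<Rightarrow> 'a) \<Rightarrow> ('f, 'p, 'v) fm \<Rightarrow> bool" where
  "sat J \<alpha> (Rel p ts) \<longleftrightarrow> rel_interp J p (map (eval_trm J \<alpha>) ts)"
| "sat J \<alpha> (Eq s t) \<longleftrightarrow> eval_trm J \<alpha> s = eval_trm J \<alpha> t"
| "sat J \<alpha> (Or \<phi> \<psi>) \<longleftrightarrow> sat J \<alpha> \<phi> \<or> sat J \<alpha> \<psi>"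
| "sat J \<alpha> (And \<phi> \<psi>) \<longleftrightarrow> sat J \<alpha> \<phi> \<and> sat J \<alpha> \<psi>"
| "sat J \<alpha> (Neg \<phi>) \<longleftrightarrow> \<not> sat J \<alpha> \<phi>"
| "sat J \<alpha> (Ex x \<phi>) \<longleftrightarrow> (\<exists>d. sat J (\<alpha>(x := d)) \<phi>)"


section \<open>States\<close>

datatype ('f, 'p, 'v) state =
    Error
  | State "('f, 'p, 'v) fm set" "('f, 'v) subst"

fun is_state :: "('f, 'p, 'v) state \<Rightarrow> bool" where
  "is_state Error \<longleftrightarrow> True"
| "is_state (State C \<theta>) \<longleftrightarrow> finite C \<and> finite (subst_dom \<theta>)"

fun idempotent_state :: "('f, 'p, 'v) state \<Rightarrow> bool" where
  "idempotent_state Error \<longleftrightarrow> True"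
| "idempotent_state (State C \<theta>) \<longleftrightarrow> idempotent \<theta>"

fun vars_state :: "('f, 'p, 'v) state \<Rightarrow> 'v set" where
  "vars_state Error = {}"
| "vars_state (State C \<theta>) = (\<Union>\<phi>\<in>C. vars_fm \<phi>) \<union> vars_subst \<theta>"

text \<open>Entailment is only ever used for states other than \<^const>\<open>Error\<close>.\<close>

fun entails :: "('f, 'p, 'a) struct \<Rightarrow> ('f, 'p, 'v) state \<Rightarrow> ('f, 'p, 'v) fm \<Rightarrow> bool" where
  "entails J Error \<phi> \<longleftrightarrow> False"
| "entails J (State C \<theta>) \<phi> \<longleftrightarrow>
     (\<forall>\<alpha>. (\<forall>\<chi>\<in>C. sat J \<alpha> (subst_fm \<chi> \<theta>)) \<longrightarrow> sat J \<alpha> (subst_fm \<phi> \<theta>))"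

definition equivalent ::
  "('f, 'p, 'a) struct \<Rightarrow> ('f, 'p, 'v) state \<Rightarrow> ('f, 'p, 'v) state \<Rightarrow> bool" where
  "equivalent J \<sigma> \<tau> \<longleftrightarrow> (\<forall>\<phi>. entails J \<sigma> \<phi> \<longleftrightarrow> entails J \<tau> \<phi>)"

definition consistent :: "('f, 'p, 'a) struct \<Rightarrow> ('f, 'p, 'v) state \<Rightarrow> bool" where
  "consistent J \<sigma> \<longleftrightarrow> \<sigma> \<noteq> Error \<and> \<not> entails J \<sigma> Falsum"

definition inconsistent :: "('f, 'p, 'a) struct \<Rightarrow> ('f, 'p, 'v) state \<Rightarrow> bool" where
  "inconsistent J \<sigma> \<longleftrightarrow> \<sigma> \<noteq> Error \<and> entails J \<sigma> Falsum"

definition cons ::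
  "('f, 'p, 'a) struct \<Rightarrow> ('f, 'p, 'v) state set \<Rightarrow> ('f, 'p, 'v) state set" where
  "cons J \<Sigma> = {\<sigma> \<in> \<Sigma>. consistent J \<sigma>}"

definition cons_plus ::
  "('f, 'p, 'a) struct \<Rightarrow> ('f, 'p, 'v) state set \<Rightarrow> ('f, 'p, 'v) state set" where
  "cons_plus J \<Sigma> = {\<sigma> \<in> \<Sigma>. \<not> inconsistent J \<sigma>}"


section \<open>Conditions on the inference map\<close>

text \<open>Replacing all occurrences of \<open>u\<close> by \<open>v\<close>, bound occurrences included. A substitution is
  treated as its set of bindings, so a binding of \<open>u\<close> becomes a binding of \<open>v\<close>. This is only
  used for \<open>v\<close> not occurring in the state.\<close>

definition replace_subst :: "'v \<Rightarrow> 'v \<Rightarrow> ('f, 'v) subst \<Rightarrow> ('f, 'v) subst" where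
  "replace_subst u v \<theta> =
     (\<lambda>x. if x = v then map_trm id (id(u := v)) (\<theta> u)
          else if x = u then Var u
          else map_trm id (id(u := v)) (\<theta> x))"

fun replace_state :: "'v \<Rightarrow> 'v \<Rightarrow> ('f, 'p, 'v) state \<Rightarrow> ('f, 'p, 'v) state" where
  "replace_state u v Error = Error"
| "replace_state u v (State C \<theta>) =
     State (map_fm id id (id(u := v)) ` C) (replace_subst u v \<theta>)"

type_synonym ('f, 'p, 'v) inference = "('f, 'p, 'v) state \<Rightarrow> ('f, 'p, 'v) state set"

definition infer_typing :: "('f, 'p, 'v) inference \<Rightarrow> bool" where
  "infer_typing infer \<longleftrightarrow> (\<forall>\<sigma> \<tau>. is_state \<sigma> \<longrightarrow> \<tau> \<in> infer \<sigma> \<longrightarrow> is_state \<tau>)"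

definition infer_equivalence ::
  "('f, 'p, 'a) struct \<Rightarrow> ('f, 'p, 'v) inference \<Rightarrow> bool" where
  "infer_equivalence J infer \<longleftrightarrow>
     (\<forall>C \<theta> C' \<theta>'. is_state (State C \<theta>) \<longrightarrow> State C' \<theta>' \<in> infer (State C \<theta>) \<longrightarrow>
        (\<forall>\<phi>. entails J (State C \<theta>) \<phi> \<longleftrightarrow> entails J (State C' \<theta>') \<phi>))"

definition infer_renaming :: "('f, 'p, 'v) inference \<Rightarrow> bool" where
  "infer_renaming infer \<longleftrightarrow>
     (\<forall>C \<theta> C' \<theta>' u v. is_state (State C \<theta>) \<longrightarrow> State C' \<theta>' \<in> infer (State C \<theta>) \<longrightarrow>
        u \<notin> vars_state (State C \<theta>) \<longrightarrow>
        v \<notin> vars_state (State C \<theta>) \<union> vars_state (State C' \<theta>') \<longrightarrow>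
        replace_state u v (State C' \<theta>') \<in> infer (State C \<theta>))"

definition infer_inconsistency ::
  "('f, 'p, 'a) struct \<Rightarrow> ('f, 'p, 'v) inference \<Rightarrow> bool" where
  "infer_inconsistency J infer \<longleftrightarrow>
     (\<forall>C \<theta>. is_state (State C \<theta>) \<longrightarrow> infer (State C \<theta>) = {} \<longrightarrow>
        entails J (State C \<theta>) Falsum)"

definition infer_error :: "('f, 'p, 'v) inference \<Rightarrow> bool" where
  "infer_error infer \<longleftrightarrow> infer Error = {Error}"

definition infer_identity :: "('f, 'p, 'v) inference \<Rightarrow> bool" where
  "infer_identity infer \<longleftrightarrow>
     (\<forall>\<theta>. is_state (State {} \<theta> :: ('f, 'p, 'v) state) \<longrightarrow>
        infer (State {} \<theta>) = {State {} \<theta>})"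

definition infer_conditions ::
  "('f, 'p, 'a) struct \<Rightarrow> ('f, 'p, 'v) inference \<Rightarrow> bool" where
  "infer_conditions J infer \<longleftrightarrow>
     infer_typing infer \<and> infer_equivalence J infer \<and> infer_renaming infer \<and>
     infer_inconsistency J infer \<and> infer_error infer \<and> infer_identity infer"

text \<open>Dropping a variable preserves information only for idempotent substitutions: over the natural
  numbers, dropping \<open>u\<close> from the store \<open>{u > 0}\<close> with substitution \<open>u \<mapsto> u + 1\<close> yields the inconsistent
  constraint \<open>\<exists>u. u = u + 1 \<and> u > 0\<close>, although that state is equivalent to the store \<open>{u > 0}\<close> with
  the empty substitution.\<close>

definition infer_preserves_idempotency :: "('f, 'p, 'v) inference \<Rightarrow> bool" where
  "infer_preserves_idempotency infer \<longleftrightarrow>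
     (\<forall>\<sigma> \<tau>. is_state \<sigma> \<longrightarrow> idempotent_state \<sigma> \<longrightarrow> \<tau> \<in> infer \<sigma> \<longrightarrow> idempotent_state \<tau>)"


section \<open>Dropping a variable\<close>

definition DROP :: "'v \<Rightarrow> ('f, 'v) subst \<Rightarrow> ('f, 'v) subst" where
  "DROP u \<theta> = \<theta>(u := Var u)"

definition store_at :: "('f, 'p, 'v) fm set \<Rightarrow> 'v \<Rightarrow> ('f, 'p, 'v) fm set" where
  "store_at C u = {\<phi> \<in> C. u \<in> free_vars \<phi>}"

definition drop_fm ::
  "'v \<Rightarrow> ('f, 'p, 'v) fm set \<Rightarrow> ('f, 'v) subst \<Rightarrow> ('f, 'p, 'v) fm" where
  "drop_fm u C \<eta> =
     Ex u (conj_list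
       (Eq (Var u) (\<eta> u)
        # map (\<lambda>y. Eq (Var y) (\<eta> y)) (enum_set {y. y \<noteq> u \<and> u \<in> vars_trm (\<eta> y)})
        @ enum_set (store_at C u)))"

fun drop_var :: "'v \<Rightarrow> ('f, 'p, 'v) state \<Rightarrow> ('f, 'p, 'v) state" where
  "drop_var u Error = Error"
| "drop_var u (State C \<eta>) =
     (if store_at C u = {} then State C (DROP u \<eta>)
      else State ((C - store_at C u) \<union> {drop_fm u C \<eta>}) (DROP u \<eta>))"


section \<open>The semantics\<close>

text \<open>The choice of fresh variables is a parameter: \<open>fresh V \<sigma> \<psi>\<close> is the variable chosen to
  instantiate the quantifier of \<open>\<psi>\<close> in state \<open>\<sigma>\<close>, where \<open>V\<close> contains the variables in use.\<close>

type_synonym ('f, 'p, 'v) choice =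
  "'v set \<Rightarrow> ('f, 'p, 'v) state \<Rightarrow> ('f, 'p, 'v) fm \<Rightarrow> 'v"

definition fresh_choice :: "('f, 'p, 'v) choice \<Rightarrow> bool" where
  "fresh_choice fresh \<longleftrightarrow>
     (\<forall>V \<sigma> \<psi>. finite V \<longrightarrow> is_state \<sigma> \<longrightarrow> fresh V \<sigma> \<psi> \<notin> V \<union> vars_state \<sigma> \<union> vars_fm \<psi>)"

primrec connectives :: "('f, 'p, 'v) fm \<Rightarrow> nat" where
  "connectives (Rel p ts) = 0"
| "connectives (Eq s t) = 0"
| "connectives (Or \<phi> \<psi>) = Suc (connectives \<phi> + connectives \<psi>)"
| "connectives (And \<phi> \<psi>) = Suc (connectives \<phi> + connectives \<psi>)"
| "connectives (Neg \<phi>) = Suc (connectives \<phi>)"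
| "connectives (Ex x \<phi>) = Suc (connectives \<phi>)"

lemma connectives_subst_fm [simp]: "connectives (subst_fm \<phi> \<theta>) = connectives \<phi>"
  by (induction \<phi> arbitrary: \<theta>) (simp_all add: Let_def)

text \<open>The set \<open>V\<close> starts as the set of variables of the formula being evaluated and grows with
  each variable introduced for a quantifier. Freshness with respect to the current state and
  subformula alone would not do: after \<open>\<exists>x. y = x\<close> has been evaluated with \<open>u\<close> for \<open>x\<close>, the
  state may bind \<open>y\<close> to \<open>u\<close>, which must not be confused with a variable of a formula that is
  still to be evaluated.\<close>

function (sequential) sem ::
  "('f, 'p, 'a) struct \<Rightarrow> ('f, 'p, 'v) inference \<Rightarrow> ('f, 'p, 'v) choice \<Rightarrow> 'v set \<Rightarrow>
   ('f, 'p, 'v) fm \<Rightarrow> ('f, 'p, 'v) state \<Rightarrow> ('f, 'p, 'v) state set"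
where
  "sem J infer fresh V \<phi> Error = {Error}"
| "sem J infer fresh V (Rel p ts) (State C \<theta>) = infer (State (C \<union> {Rel p ts}) \<theta>)"
| "sem J infer fresh V (Eq s t) (State C \<theta>) = infer (State (C \<union> {Eq s t}) \<theta>)"
| "sem J infer fresh V (Or \<phi>1 \<phi>2) (State C \<theta>) =
     sem J infer fresh V \<phi>1 (State C \<theta>) \<union> sem J infer fresh V \<phi>2 (State C \<theta>)"
| "sem J infer fresh V (And \<phi>1 \<phi>2) (State C \<theta>) =
     (\<Union>\<sigma> \<in> sem J infer fresh V \<phi>1 (State C \<theta>). sem J infer fresh V \<phi>2 \<sigma>)"
| "sem J infer fresh V (Neg \<phi>) (State C \<theta>) =
     (let \<Sigma> = sem J infer fresh V \<phi> (State C \<theta>) in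
      if cons_plus J \<Sigma> = {} then infer (State C \<theta>)
      else if \<exists>\<sigma> \<in> cons J \<Sigma>. equivalent J \<sigma> (State C \<theta>) then {}
      else infer (State (C \<union> {Neg \<phi>}) \<theta>))"
| "sem J infer fresh V (Ex x \<phi>) (State C \<theta>) =
     (let u = fresh V (State C \<theta>) (Ex x \<phi>) in
      \<Union>\<sigma> \<in> cons_plus J
             (sem J infer fresh (insert u V) (subst_fm \<phi> (Var(x := Var u))) (State C \<theta>)).
        infer (drop_var u \<sigma>))"
  by pat_completeness auto
termination
  by (relation "measure (\<lambda>(J, infer, fresh, V, \<phi>, \<sigma>). connectives \<phi>)") auto

definition denotation ::
  "('f, 'p, 'a) struct \<Rightarrow> ('f, 'p, 'v) inference \<Rightarrow> ('f, 'p, 'v) choice \<Rightarrow>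
   ('f, 'p, 'v) fm \<Rightarrow> ('f, 'p, 'v) state \<Rightarrow> ('f, 'p, 'v) state set" where
  "denotation J infer fresh \<phi> \<sigma> = sem J infer fresh (vars_fm \<phi>) \<phi> \<sigma>"

end

theory Submission
  imports Defs
begin

text \<open>
  A state with an idempotent substitution stands for the set of its models, namely the assignments
  that satisfy the store and all equations \<open>x = x\<theta>\<close>. This set is definable by a formula, so a
  consistent inference step preserves it exactly. Dropping \<open>u\<close> enlarges it, but by no more than
  changes of the value of \<open>u\<close>. By induction on \<open>\<phi>\<close>, the models of the states
  computed for \<open>\<phi>\<close> from \<open>\<sigma>\<close> and the models of \<open>\<sigma>\<close> satisfying \<open>\<phi>\<close> therefore agree up to the values of
  variables outside the set \<open>V\<close> of variables in use; this symmetric statement gives both claims.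
\<close>

section \<open>Substitution and coincidence lemmas\<close>

lemma finite_vars_trm [simp]: "finite (vars_trm t)"
  by (induction t) auto

lemma finite_vars_fm [simp]: "finite (vars_fm \<phi>)"
  by (induction \<phi>) auto

lemma free_vars_subset_vars_fm: "free_vars \<phi> \<subseteq> vars_fm \<phi>"
  by (induction \<phi>) auto

lemma eval_trm_cong:
  "(\<And>x. x \<in> vars_trm t \<Longrightarrow> \<alpha> x = \<beta> x) \<Longrightarrow> eval_trm J \<alpha> t = eval_trm J \<beta> t"
proof (induction t)
  case (Fun f ts)
  have "map (eval_trm J \<alpha>) ts = map (eval_trm J \<beta>) ts"
    using Fun by (intro map_cong) auto
  then show ?case by (simp only: eval_trm.simps)
qed simp

lemma sat_cong:
  "(\<And>x. x \<in> free_vars \<phi> \<Longrightarrow> \<alpha> x = \<beta> x) \<Longrightarrow> sat J \<alpha> \<phi> \<longleftrightarrow> sat J \<beta> \<phi>"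
proof (induction \<phi> arbitrary: \<alpha> \<beta>)
  case (Rel p ts)
  have "map (eval_trm J \<alpha>) ts = map (eval_trm J \<beta>) ts"
    using Rel by (intro map_cong eval_trm_cong) auto
  then show ?case by (simp only: sat.simps)
next
  case (Eq s t)
  have "eval_trm J \<alpha> s = eval_trm J \<beta> s" "eval_trm J \<alpha> t = eval_trm J \<beta> t"
    by (rule eval_trm_cong, rule Eq.prems, simp)+
  then show ?case by simp
next
  case (Or \<phi> \<psi>)
  have "sat J \<alpha> \<phi> \<longleftrightarrow> sat J \<beta> \<phi>" "sat J \<alpha> \<psi> \<longleftrightarrow> sat J \<beta> \<psi>"
    by (rule Or.IH, rule Or.prems, simp)+
  then show ?case by simp
next
  case (And \<phi> \<psi>)
  have "sat J \<alpha> \<phi> \<longleftrightarrow> sat J \<beta> \<phi>" "sat J \<alpha> \<psi> \<longleftrightarrow> sat J \<beta> \<psi>"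
    by (rule And.IH, rule And.prems, simp)+
  then show ?case by simp
next
  case (Neg \<phi>)
  have "sat J \<alpha> \<phi> \<longleftrightarrow> sat J \<beta> \<phi>"
    by (rule Neg.IH, rule Neg.prems, simp)
  then show ?case by simp
next
  case (Ex x \<phi>)
  have "sat J (\<alpha>(x := d)) \<phi> \<longleftrightarrow> sat J (\<beta>(x := d)) \<phi>" for d
    by (rule Ex.IH) (use Ex.prems in auto)
  then show ?case by simp
qed

lemma eval_subst_trm:
  "eval_trm J \<alpha> (subst_trm t \<theta>) = eval_trm J (\<lambda>x. eval_trm J \<alpha> (\<theta> x)) t"
proof (induction t)
  case (Fun f ts)
  then show ?case by (simp add: comp_def cong: map_cong)
qed simp

text \<open>Renaming a bound variable is harmless because its new name \<open>z\<close> avoids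
  \<open>W\<close>, the variables of the terms put in for the free variables of
  \<open>Ex x \<phi>\<close>; changing the value at \<open>z\<close> leaves those terms alone. The
  variable type is infinite so that such a name exists whenever \<open>x\<close> would
  capture.\<close>

lemma sat_subst_fm:
  fixes \<phi> :: "('f, 'p, 'v :: infinite) fm"
  shows "sat J \<alpha> (subst_fm \<phi> \<theta>) \<longleftrightarrow> sat J (\<lambda>x. eval_trm J \<alpha> (\<theta> x)) \<phi>"
proof (induction \<phi> arbitrary: \<alpha> \<theta>)
  case (Rel p ts)
  then show ?case by (simp add: comp_def eval_subst_trm)
next
  case (Ex x \<phi>)
  define W where "W = (\<Union>y\<in>free_vars \<phi> - {x}. vars_trm (\<theta> y))"
  define z where "z = (if x \<in> W then SOME z. z \<notin> W \<union> vars_fm \<phi> else x)"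
  have "finite (W \<union> vars_fm \<phi>)"
    unfolding W_def using finite_subset[OF free_vars_subset_vars_fm[of \<phi>]] by auto
  then have "\<exists>z. z \<notin> W \<union> vars_fm \<phi>"
    using ex_new_if_finite infinite_UNIV by blast
  then have z: "z \<notin> W"
    unfolding z_def using someI_ex[of "\<lambda>z. z \<notin> W \<union> vars_fm \<phi>"] by auto
  have "sat J (\<alpha>(z := d)) (subst_fm \<phi> (\<theta>(x := Var z))) \<longleftrightarrow>
        sat J ((\<lambda>y. eval_trm J \<alpha> (\<theta> y))(x := d)) \<phi>" for d
    unfolding Ex.IH
  proof (rule sat_cong)
    fix y assume y: "y \<in> free_vars \<phi>"
    show "eval_trm J (\<alpha>(z := d)) ((\<theta>(x := Var z)) y) = ((\<lambda>y. eval_trm J \<alpha> (\<theta> y))(x := d)) y"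
    proof (cases "y = x")
      case False
      then have "z \<notin> vars_trm (\<theta> y)" using y z unfolding W_def by auto
      with False show ?thesis by (auto intro: eval_trm_cong)
    qed simp
  qed
  then show ?case by (simp add: Let_def flip: W_def z_def)
qed (simp_all add: eval_subst_trm)

lemma vars_subst_trm: "vars_trm (subst_trm t \<theta>) = (\<Union>x\<in>vars_trm t. vars_trm (\<theta> x))"
  by (induction t) auto

text \<open>In the quantifier case only the binding of \<open>x\<close> to \<open>Var z\<close>
  could contribute a variable outside the bound, and that variable is \<open>z\<close>, which
  \<open>Ex z\<close> removes. This works for whichever \<open>z\<close> the substitution
  picks.\<close>

lemma free_vars_subst_fm:
  "free_vars (subst_fm \<phi> \<theta>) \<subseteq> (\<Union>x\<in>free_vars \<phi>. vars_trm (\<theta> x))"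
proof (induction \<phi> arbitrary: \<theta>)
  case (Ex x \<phi>)
  obtain z where z: "subst_fm (Ex x \<phi>) \<theta> = Ex z (subst_fm \<phi> (\<theta>(x := Var z)))"
    by (simp add: Let_def)
  show ?case
  proof
    fix v assume "v \<in> free_vars (subst_fm (Ex x \<phi>) \<theta>)"
    then have v: "v \<in> free_vars (subst_fm \<phi> (\<theta>(x := Var z)))" "v \<noteq> z"
      unfolding z by simp_all
    then obtain y where "y \<in> free_vars \<phi>" "v \<in> vars_trm ((\<theta>(x := Var z)) y)"
      using Ex.IH[of "\<theta>(x := Var z)"] by blast
    with v(2) show "v \<in> (\<Union>y\<in>free_vars (Ex x \<phi>). vars_trm (\<theta> y))"
      by (cases "y = x") auto
  qed
next
  case (Or \<phi> \<psi>)
  then show ?case by (simp add: UN_Un le_supI1 le_supI2)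
next
  case (And \<phi> \<psi>)
  then show ?case by (simp add: UN_Un le_supI1 le_supI2)
qed (simp_all add: vars_subst_trm)

section \<open>Finite conjunctions and idempotence\<close>

lemma sat_Falsum [simp]: "\<not> sat J \<alpha> Falsum"
  by (simp add: Falsum_def)

lemma sat_conj_list [simp]: "sat J \<alpha> (conj_list \<phi>s) \<longleftrightarrow> (\<forall>\<phi>\<in>set \<phi>s. sat J \<alpha> \<phi>)"
  by (induction \<phi>s rule: conj_list.induct) auto

lemma set_enum_set [simp]: "finite A \<Longrightarrow> set (enum_set A) = A"
  unfolding enum_set_def using someI_ex[OF finite_distinct_list[of A]] by auto

lemma subst_trm_ident_iff: "subst_trm t \<theta> = t \<longleftrightarrow> (\<forall>x\<in>vars_trm t. \<theta> x = Var x)"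
proof (induction t)
  case (Fun f ts)
  have "map (\<lambda>t. subst_trm t \<theta>) ts = ts \<longleftrightarrow> (\<forall>t\<in>set ts. subst_trm t \<theta> = t)"
    by (induction ts) auto
  with Fun show ?case by auto
qed simp

text \<open>The form used for \<open>DROP\<close>: variables occurring in the terms
  \<open>\<theta> x\<close> are themselves unbound.\<close>

lemma idempotent_iff: "idempotent \<theta> \<longleftrightarrow> (\<forall>x. \<forall>y\<in>vars_trm (\<theta> x). \<theta> y = Var y)"
  by (simp add: idempotent_def subst_trm_ident_iff)


section \<open>Models of a state\<close>

text \<open>\<^const>\<open>Error\<close> gets all assignments, so that the states in \<^const>\<open>cons_plus\<close> are
  exactly those with a model.\<close>

fun models :: "('f, 'p, 'a) struct \<Rightarrow> ('f, 'p, 'v) state \<Rightarrow> ('v \<Rightarrow> 'a) set" where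
  "models J Error = UNIV"
| "models J (State C \<theta>) =
     {\<beta>. (\<forall>x. eval_trm J \<beta> (\<theta> x) = \<beta> x) \<and> (\<forall>\<chi>\<in>C. sat J \<beta> \<chi>)}"

definition valid_state :: "('f, 'p, 'v) state \<Rightarrow> bool" where
  "valid_state \<sigma> \<longleftrightarrow> is_state \<sigma> \<and> idempotent_state \<sigma>"

lemma valid_state_Error [simp]: "valid_state Error"
  by (simp add: valid_state_def)

text \<open>The map sending \<open>\<alpha>\<close> to
  \<open>\<lambda>x. eval_trm J \<alpha> (\<theta> x)\<close> fixes every solution of the bindings,
  and by idempotence all its values are solutions. Entailment, which quantifies over all
  \<open>\<alpha>\<close>, therefore quantifies over the models.\<close>

lemma entails_iff_models:
  fixes C :: "('f, 'p, 'v :: infinite) fm set"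
  assumes "idempotent \<theta>"
  shows "entails J (State C \<theta>) \<phi> \<longleftrightarrow> (\<forall>\<beta>\<in>models J (State C \<theta>). sat J \<beta> \<phi>)"
proof
  assume "entails J (State C \<theta>) \<phi>"
  then have *: "sat J (\<lambda>x. eval_trm J \<alpha> (\<theta> x)) \<phi>"
    if "\<forall>\<chi>\<in>C. sat J (\<lambda>x. eval_trm J \<alpha> (\<theta> x)) \<chi>" for \<alpha>
    using that by (simp add: sat_subst_fm)
  show "\<forall>\<beta>\<in>models J (State C \<theta>). sat J \<beta> \<phi>"
  proof
    fix \<beta> assume "\<beta> \<in> models J (State C \<theta>)"
    then show "sat J \<beta> \<phi>" using *[of \<beta>] by simp
  qed
next
  assume *: "\<forall>\<beta>\<in>models J (State C \<theta>). sat J \<beta> \<phi>"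
  have "eval_trm J (\<lambda>y. eval_trm J \<alpha> (\<theta> y)) (\<theta> x) = eval_trm J \<alpha> (\<theta> x)" for \<alpha> x
    using assms unfolding idempotent_def by (metis eval_subst_trm)
  with * show "entails J (State C \<theta>) \<phi>"
    by (auto simp: sat_subst_fm)
qed

lemma entails_Falsum_iff:
  fixes C :: "('f, 'p, 'v :: infinite) fm set"
  shows "idempotent \<theta> \<Longrightarrow> entails J (State C \<theta>) Falsum \<longleftrightarrow> models J (State C \<theta>) = {}"
  by (auto simp: entails_iff_models simp del: entails.simps models.simps)

lemma inconsistent_iff_models:
  fixes \<sigma> :: "('f, 'p, 'v :: infinite) state"
  shows "valid_state \<sigma> \<Longrightarrow> inconsistent J \<sigma> \<longleftrightarrow> models J \<sigma> = {}"
  by (cases \<sigma>)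
    (simp_all add: inconsistent_def valid_state_def entails_Falsum_iff del: entails.simps models.simps(2))

text \<open>Outside \<open>subst_dom \<theta>\<close> the equations are trivial, so finitely many
  equations and the finite store suffice.\<close>

lemma models_definable:
  assumes "is_state (State C \<theta>)"
  obtains \<delta> where "\<And>\<beta>. sat J \<beta> \<delta> \<longleftrightarrow> \<beta> \<in> models J (State C \<theta>)"
proof
  define \<delta> where
    "\<delta> = conj_list (map (\<lambda>x. Eq (\<theta> x) (Var x)) (enum_set (subst_dom \<theta>)) @ enum_set C)"
  have "(\<forall>x. eval_trm J \<beta> (\<theta> x) = \<beta> x) \<longleftrightarrow> (\<forall>x\<in>subst_dom \<theta>. eval_trm J \<beta> (\<theta> x) = \<beta> x)" for \<beta>
    by (auto simp: subst_dom_def) (metis eval_trm.simps(1))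
  then show "sat J \<beta> \<delta> \<longleftrightarrow> \<beta> \<in> models J (State C \<theta>)" for \<beta>
    using assms by (simp add: \<delta>_def ball_Un)
qed

text \<open>Each state entails its own defining formula, hence so does the other state; this gives
  both inclusions.\<close>

lemma models_equivalent:
  fixes C D :: "('f, 'p, 'v :: infinite) fm set"
  assumes "valid_state (State C \<theta>)" "valid_state (State D \<eta>)"
    and "equivalent J (State C \<theta>) (State D \<eta>)"
  shows "models J (State C \<theta>) = models J (State D \<eta>)"
proof -
  have eq: "(\<forall>\<beta>\<in>models J (State C \<theta>). sat J \<beta> \<phi>) \<longleftrightarrow> (\<forall>\<beta>\<in>models J (State D \<eta>). sat J \<beta> \<phi>)" for \<phi>
    using assms entails_iff_models[of \<theta> J C \<phi>] entails_iff_models[of \<eta> J D \<phi>]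
    unfolding valid_state_def equivalent_def by fastforce
  obtain \<gamma> where \<gamma>: "\<And>\<beta>. sat J \<beta> \<gamma> \<longleftrightarrow> \<beta> \<in> models J (State C \<theta>)"
    using models_definable[of C \<theta> J] assms(1) valid_state_def by blast
  obtain \<delta> where \<delta>: "\<And>\<beta>. sat J \<beta> \<delta> \<longleftrightarrow> \<beta> \<in> models J (State D \<eta>)"
    using models_definable[of D \<eta> J] assms(2) valid_state_def by blast
  show ?thesis using eq[of \<gamma>] eq[of \<delta>] unfolding \<gamma> \<delta> by blast
qed

lemma models_fresh_upd:
  assumes "u \<notin> vars_state (State C \<theta>)" and \<beta>: "\<beta> \<in> models J (State C \<theta>)"
  shows "\<beta>(u := d) \<in> models J (State C \<theta>)"
proof -
  have u: "\<theta> u = Var u"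
    using assms(1) by (auto simp: vars_subst_def subst_dom_def)
  have ux: "u \<notin> vars_trm (\<theta> x)" if "x \<noteq> u" for x
    using assms(1) that by (cases "\<theta> x = Var x") (auto simp: vars_subst_def subst_dom_def)
  have uC: "u \<notin> free_vars \<chi>" if "\<chi> \<in> C" for \<chi>
    using assms(1) that free_vars_subset_vars_fm[of \<chi>] by auto
  have "eval_trm J (\<beta>(u := d)) (\<theta> x) = (\<beta>(u := d)) x" for x
  proof (cases "x = u")
    case False
    then have "eval_trm J (\<beta>(u := d)) (\<theta> x) = eval_trm J \<beta> (\<theta> x)"
      using ux by (intro eval_trm_cong) auto
    then show ?thesis using \<beta> False by simp
  qed (simp add: u)
  moreover have "sat J (\<beta>(u := d)) \<chi>" if "\<chi> \<in> C" for \<chi>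
  proof -
    have "sat J (\<beta>(u := d)) \<chi> \<longleftrightarrow> sat J \<beta> \<chi>"
      using uC[OF that] by (intro sat_cong) auto
    with \<beta> that show ?thesis by simp
  qed
  ultimately show ?thesis by simp
qed


section \<open>Dropping a variable\<close>

lemma valid_state_drop_var:
  assumes "valid_state \<sigma>"
  shows "valid_state (drop_var u \<sigma>)"
proof (cases \<sigma>)
  case (State C \<theta>)
  have "subst_dom (DROP u \<theta>) \<subseteq> subst_dom \<theta>"
    by (auto simp: subst_dom_def DROP_def)
  moreover have "idempotent (DROP u \<theta>)" if "idempotent \<theta>"
    using that by (auto simp: idempotent_iff DROP_def)
  ultimately show ?thesis
    using assms State by (auto simp: valid_state_def intro: finite_subset)
qed simp

text \<open>The equation for \<open>u\<close> and those for the other \<open>y\<close> merge into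
  one condition. The \<open>y\<close> whose terms contain \<open>u\<close> lie in
  \<open>subst_dom \<eta>\<close>, so there are finitely many and \<open>enum_set\<close> really
  lists them.\<close>

lemma sat_drop_fm:
  assumes "is_state (State C \<eta>)"
  shows "sat J \<beta> (drop_fm u C \<eta>) \<longleftrightarrow>
    (\<exists>d. (\<forall>y. y = u \<or> u \<in> vars_trm (\<eta> y) \<longrightarrow>
              eval_trm J (\<beta>(u := d)) (\<eta> y) = (\<beta>(u := d)) y) \<and>
         (\<forall>\<chi>\<in>store_at C u. sat J (\<beta>(u := d)) \<chi>))"
proof -
  have "{y. y \<noteq> u \<and> u \<in> vars_trm (\<eta> y)} \<subseteq> subst_dom \<eta>"
    by (auto simp: subst_dom_def)
  then have fin: "finite {y. y \<noteq> u \<and> u \<in> vars_trm (\<eta> y)}" "finite (store_at C u)"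
    using assms by (auto simp: store_at_def intro: finite_subset)
  have "sat J \<beta> (drop_fm u C \<eta>) \<longleftrightarrow>
    (\<exists>d. eval_trm J (\<beta>(u := d)) (\<eta> u) = d \<and>
         (\<forall>y. y \<noteq> u \<and> u \<in> vars_trm (\<eta> y) \<longrightarrow>
              eval_trm J (\<beta>(u := d)) (\<eta> y) = (\<beta>(u := d)) y) \<and>
         (\<forall>\<chi>\<in>store_at C u. sat J (\<beta>(u := d)) \<chi>))"
    unfolding drop_fm_def using fin by (simp add: ball_Un eq_commute)
  also have "\<dots> \<longleftrightarrow> (\<exists>d. (\<forall>y. y = u \<or> u \<in> vars_trm (\<eta> y) \<longrightarrow>
              eval_trm J (\<beta>(u := d)) (\<eta> y) = (\<beta>(u := d)) y) \<and>
         (\<forall>\<chi>\<in>store_at C u. sat J (\<beta>(u := d)) \<chi>))"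
    by (intro ex_cong1) auto
  finally show ?thesis .
qed

text \<open>The existential in \<open>drop_fm\<close> is witnessed by the present value
  \<open>\<beta> u\<close>, and \<open>DROP\<close> only removes a constraint.\<close>

lemma models_drop_var_superset:
  assumes "valid_state \<sigma>"
  shows "models J \<sigma> \<subseteq> models J (drop_var u \<sigma>)"
proof (cases \<sigma>)
  case (State C \<eta>)
  show ?thesis
  proof
    fix \<beta> assume \<beta>: "\<beta> \<in> models J \<sigma>"
    then have "sat J \<beta> (drop_fm u C \<eta>)"
      using assms State sat_drop_fm[of C \<eta> J \<beta> u]
      by (auto simp: valid_state_def store_at_def intro!: exI[of _ "\<beta> u"])
    with \<beta> show "\<beta> \<in> models J (drop_var u \<sigma>)"
      using State by (auto simp: DROP_def)
  qed
qed simp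

text \<open>The converse inclusion would fail: if \<open>u\<close> is unbound and \<open>y\<close> is bound to \<open>u\<close>, the binding
  survives the drop.\<close>

lemma models_drop_var_upd:
  assumes \<sigma>: "valid_state (State C \<eta>)" and \<beta>: "\<beta> \<in> models J (drop_var u (State C \<eta>))"
  obtains d where "\<beta>(u := d) \<in> models J (State C \<eta>)"
proof -
  have idem: "idempotent \<eta>" using \<sigma> by (simp add: valid_state_def)
  have bind: "eval_trm J \<beta> (\<eta> y) = \<beta> y" if "y \<noteq> u" for y
    using \<beta> that by (auto simp: DROP_def split: if_splits)
  have store: "sat J \<beta> \<chi>" if "\<chi> \<in> C" "u \<notin> free_vars \<chi>" for \<chi>
    using \<beta> that by (auto simp: store_at_def split: if_splits)
  obtain d where
    bind_u: "\<And>y. y = u \<or> u \<in> vars_trm (\<eta> y) \<Longrightarrow>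
      eval_trm J (\<beta>(u := d)) (\<eta> y) = (\<beta>(u := d)) y"
    and store_u: "\<And>\<chi>. \<chi> \<in> store_at C u \<Longrightarrow> sat J (\<beta>(u := d)) \<chi>"
  proof (cases "store_at C u = {}")
    case False
    then have "sat J \<beta> (drop_fm u C \<eta>)" using \<beta> by simp
    then show ?thesis using that \<sigma> sat_drop_fm[of C \<eta> J \<beta> u] unfolding valid_state_def by blast
  next
    case True
    show ?thesis
    proof (cases "\<eta> u = Var u")
      case unbound: True
      \<comment> \<open>With \<open>u\<close> unbound, dropping does not change the state, so the
        old value of \<open>u\<close> will do.\<close>
      then show ?thesis using True bind that[of "\<beta> u"] by (metis empty_iff eval_trm.simps(1) fun_upd_triv)
    next
      case False
      \<comment> \<open>A bound \<open>u\<close> cannot occur in any \<open>\<eta> y\<close>, by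
        idempotence. Hence \<open>\<eta> u\<close> has a value independent of that of
        \<open>u\<close>, and this value is taken for \<open>d\<close>.\<close>
      then have no_u: "u \<notin> vars_trm (\<eta> y)" for y
        using idem by (auto simp: idempotent_iff)
      then have "eval_trm J (\<beta>(u := d)) (\<eta> u) = eval_trm J \<beta> (\<eta> u)" for d
        by (intro eval_trm_cong) auto
      then show ?thesis using True no_u that[of "eval_trm J \<beta> (\<eta> u)"] by auto
    qed
  qed
  have "eval_trm J (\<beta>(u := d)) (\<eta> y) = (\<beta>(u := d)) y" for y
  proof (cases "y = u \<or> u \<in> vars_trm (\<eta> y)")
    case False
    then have "eval_trm J (\<beta>(u := d)) (\<eta> y) = eval_trm J \<beta> (\<eta> y)"
      by (intro eval_trm_cong) auto
    with False bind show ?thesis by simp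
  qed (rule bind_u)
  moreover have "sat J (\<beta>(u := d)) \<chi>" if "\<chi> \<in> C" for \<chi>
  proof (cases "u \<in> free_vars \<chi>")
    case False
    then have "sat J (\<beta>(u := d)) \<chi> \<longleftrightarrow> sat J \<beta> \<chi>" by (intro sat_cong) auto
    with False store that show ?thesis by simp
  qed (use store_u that in \<open>simp add: store_at_def\<close>)
  ultimately have "\<beta>(u := d) \<in> models J (State C \<eta>)" by simp
  then show thesis by (rule that)
qed


section \<open>Adequacy of the semantics\<close>

text \<open>The second conjunct is soundness, the third completeness. \<open>Error\<close> is exempt
  from soundness, yet as a member of \<open>\<Sigma>\<close> it fulfils completeness on its own, all
  assignments being its models. Agreement is asked only on \<open>V\<close> because a dropped
  variable may change its value.\<close>

definition adequate ::
  "('f, 'p, 'a) struct \<Rightarrow> 'v set \<Rightarrow> ('f, 'p, 'v) fm \<Rightarrow> ('f, 'p, 'v) state \<Rightarrow>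
   ('f, 'p, 'v) state set \<Rightarrow> bool" where
  "adequate J V \<phi> \<sigma> \<Sigma> \<longleftrightarrow>
     (\<forall>\<tau>\<in>\<Sigma>. valid_state \<tau>) \<and>
     (\<forall>\<tau>\<in>\<Sigma>. \<tau> \<noteq> Error \<longrightarrow> (\<forall>\<beta>\<in>models J \<tau>.
        sat J \<beta> \<phi> \<and> (\<exists>\<alpha>\<in>models J \<sigma>. \<forall>x\<in>V. \<alpha> x = \<beta> x))) \<and>
     (\<forall>\<alpha>\<in>models J \<sigma>. sat J \<alpha> \<phi> \<longrightarrow> (\<exists>\<tau>\<in>\<Sigma>. \<exists>\<beta>\<in>models J \<tau>. \<forall>x\<in>V. \<beta> x = \<alpha> x))"

lemma adequateI:
  assumes "\<And>\<tau>. \<tau> \<in> \<Sigma> \<Longrightarrow> valid_state \<tau>"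
    and "\<And>\<tau> \<beta>. \<tau> \<in> \<Sigma> \<Longrightarrow> \<tau> \<noteq> Error \<Longrightarrow> \<beta> \<in> models J \<tau> \<Longrightarrow>
      sat J \<beta> \<phi> \<and> (\<exists>\<alpha>\<in>models J \<sigma>. \<forall>x\<in>V. \<alpha> x = \<beta> x)"
    and "\<And>\<alpha>. \<alpha> \<in> models J \<sigma> \<Longrightarrow> sat J \<alpha> \<phi> \<Longrightarrow>
      \<exists>\<tau>\<in>\<Sigma>. \<exists>\<beta>\<in>models J \<tau>. \<forall>x\<in>V. \<beta> x = \<alpha> x"
  shows "adequate J V \<phi> \<sigma> \<Sigma>"
  using assms unfolding adequate_def by blast

lemma adequate_valid: "adequate J V \<phi> \<sigma> \<Sigma> \<Longrightarrow> \<tau> \<in> \<Sigma> \<Longrightarrow> valid_state \<tau>"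
  unfolding adequate_def by blast

lemma adequate_sat:
  "adequate J V \<phi> \<sigma> \<Sigma> \<Longrightarrow> \<tau> \<in> \<Sigma> \<Longrightarrow> \<tau> \<noteq> Error \<Longrightarrow> \<beta> \<in> models J \<tau> \<Longrightarrow> sat J \<beta> \<phi>"
  unfolding adequate_def by blast

lemma adequate_sound:
  assumes "adequate J V \<phi> \<sigma> \<Sigma>" "\<tau> \<in> \<Sigma>" "\<tau> \<noteq> Error" "\<beta> \<in> models J \<tau>"
  obtains \<alpha> where "\<alpha> \<in> models J \<sigma>" "\<And>x. x \<in> V \<Longrightarrow> \<alpha> x = \<beta> x"
  using assms unfolding adequate_def by metis

lemma adequate_complete:
  assumes "adequate J V \<phi> \<sigma> \<Sigma>" "\<alpha> \<in> models J \<sigma>" "sat J \<alpha> \<phi>"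
  obtains \<tau> \<beta> where "\<tau> \<in> \<Sigma>" "\<beta> \<in> models J \<tau>" "\<And>x. x \<in> V \<Longrightarrow> \<beta> x = \<alpha> x"
  using assms unfolding adequate_def by metis

lemma mem_cons_plus_iff:
  fixes \<sigma> :: "('f, 'p, 'v :: infinite) state"
  assumes "adequate J V \<phi> \<sigma> \<Sigma>"
  shows "\<tau> \<in> cons_plus J \<Sigma> \<longleftrightarrow> \<tau> \<in> \<Sigma> \<and> models J \<tau> \<noteq> {}"
  using adequate_valid[OF assms] by (auto simp: cons_plus_def inconsistent_iff_models)

text \<open>By completeness, a model satisfying \<open>\<phi>\<close> would yield a result with a
  model, which \<open>cons_plus\<close> keeps. This serves both finite failure under negation and
  the second claim of the theorem.\<close>

lemma adequate_cons_plus_empty: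
  fixes \<sigma> :: "('f, 'p, 'v :: infinite) state"
  assumes "adequate J V \<phi> \<sigma> \<Sigma>" "cons_plus J \<Sigma> = {}" "\<alpha> \<in> models J \<sigma>"
  shows "\<not> sat J \<alpha> \<phi>"
  using adequate_complete[OF assms(1,3)] mem_cons_plus_iff[OF assms(1)] assms(2) by blast

section \<open>The inference map acting on models\<close>

locale inference_semantics =
  fixes J :: "('f, 'p, 'a) struct"
    and infer :: "('f, 'p, 'v :: infinite) inference"
    and fresh :: "('f, 'p, 'v) choice"
  assumes conditions: "infer_conditions J infer"
    and preserves_idempotency: "infer_preserves_idempotency infer"
    and fresh_choice: "fresh_choice fresh"
begin

lemma infer_Error [simp]: "infer Error = {Error}"
  using conditions by (simp add: infer_conditions_def infer_error_def)

lemma valid_state_infer: "valid_state \<sigma> \<Longrightarrow> \<tau> \<in> infer \<sigma> \<Longrightarrow> valid_state \<tau>"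
  using conditions preserves_idempotency
  unfolding valid_state_def infer_conditions_def infer_typing_def infer_preserves_idempotency_def
  by blast

text \<open>\<open>Error\<close> is excluded since \<open>infer\<close> may return it for a proper
  state, and its models are all assignments.\<close>

lemma models_infer:
  assumes "valid_state \<sigma>" "\<tau> \<in> infer \<sigma>" "\<tau> \<noteq> Error"
  shows "models J \<tau> = models J \<sigma>"
proof (cases \<sigma>)
  case Error
  then show ?thesis using assms by simp
next
  case (State C \<theta>)
  obtain D \<eta> where \<tau>: "\<tau> = State D \<eta>" using assms(3) by (cases \<tau>) auto
  have "is_state (State C \<theta>)" using assms(1) State valid_state_def by blast
  then have "equivalent J \<sigma> \<tau>"
    using conditions assms(2) State \<tau>
    unfolding infer_conditions_def infer_equivalence_def equivalent_def by blast
  then show ?thesis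
    using models_equivalent assms(1) valid_state_infer[OF assms(1,2)] State \<tau> by metis
qed

text \<open>A state with a model does not entail \<open>Falsum\<close>, so the inconsistency
  condition rules out an empty result. Any returned state then has \<open>\<alpha>\<close> as a
  model: models are preserved, or the state is \<open>Error\<close>.\<close>

lemma infer_covers:
  assumes "valid_state \<sigma>" "\<alpha> \<in> models J \<sigma>"
  obtains \<tau> where "\<tau> \<in> infer \<sigma>" "\<alpha> \<in> models J \<tau>"
proof -
  have "infer \<sigma> \<noteq> {}"
  proof (cases \<sigma>)
    case Error
    then show ?thesis by simp
  next
    case (State C \<theta>)
    have "infer \<sigma> = {} \<Longrightarrow> entails J \<sigma> Falsum"
      using conditions assms(1) State
      unfolding infer_conditions_def infer_inconsistency_def valid_state_def by blast
    then show ?thesis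
      using entails_Falsum_iff[of \<theta> J C] assms State by (auto simp: valid_state_def)
  qed
  then obtain \<tau> where "\<tau> \<in> infer \<sigma>" by blast
  moreover have "\<alpha> \<in> models J \<tau>"
    using models_infer[OF assms(1) \<open>\<tau> \<in> infer \<sigma>\<close>] assms(2) by (cases "\<tau> = Error") auto
  ultimately show thesis using that by blast
qed

text \<open>Covers every case that ends in a single inference step: atoms, and negation when it does
  not return the empty set.\<close>

lemma adequate_infer:
  assumes "valid_state \<rho>" and "models J \<rho> = {\<beta> \<in> models J \<sigma>. sat J \<beta> \<phi>}"
  shows "adequate J V \<phi> \<sigma> (infer \<rho>)"
proof (rule adequateI)
  show "valid_state \<tau>" if "\<tau> \<in> infer \<rho>" for \<tau>
    using valid_state_infer assms(1) that by blast
  show "sat J \<beta> \<phi> \<and> (\<exists>\<alpha>\<in>models J \<sigma>. \<forall>x\<in>V. \<alpha> x = \<beta> x)"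
    if "\<tau> \<in> infer \<rho>" "\<tau> \<noteq> Error" "\<beta> \<in> models J \<tau>" for \<tau> \<beta>
    using models_infer[OF assms(1) that(1,2)] that(3) assms(2) by auto
  show "\<exists>\<tau>\<in>infer \<rho>. \<exists>\<beta>\<in>models J \<tau>. \<forall>x\<in>V. \<beta> x = \<alpha> x"
    if "\<alpha> \<in> models J \<sigma>" "sat J \<alpha> \<phi>" for \<alpha>
  proof -
    have "\<alpha> \<in> models J \<rho>" using that assms(2) by simp
    with infer_covers[OF assms(1)] show ?thesis by (metis (no_types))
  qed
qed

lemma adequate_infer_insert:
  assumes "valid_state (State C \<theta>)"
  shows "adequate J V \<phi> (State C \<theta>) (infer (State (C \<union> {\<phi>}) \<theta>))"
  using assms by (intro adequate_infer) (auto simp: valid_state_def)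

lemma sem_Error [simp]: "sem J infer fresh V \<phi> Error = {Error}"
  by (cases \<phi>) simp_all

text \<open>The induction is on \<open>connectives\<close> because a quantifier passes to an
  instance of its body, and \<open>V\<close> is arbitrary because it grows there. As
  \<open>V\<close> contains the free variables of \<open>\<phi>\<close>, agreement on
  \<open>V\<close> carries the truth of \<open>\<phi>\<close> from one assignment to the
  other.\<close>

theorem sem_adequate:
  assumes "finite V" "free_vars \<phi> \<subseteq> V" "valid_state (State C \<theta>)"
  shows "adequate J V \<phi> (State C \<theta>) (sem J infer fresh V \<phi> (State C \<theta>))"
  using assms
proof (induction \<phi> arbitrary: V C \<theta> rule: measure_induct_rule[of connectives])
  case (less \<phi>)
  note valid = \<open>valid_state (State C \<theta>)\<close>
  show ?case
  proof (cases \<phi>)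
    case (Rel p ts)
    then show ?thesis using adequate_infer_insert[OF valid] by simp
  next
    case (Eq s t)
    then show ?thesis using adequate_infer_insert[OF valid] by simp
  next
    case (Or \<phi>1 \<phi>2)
    have "adequate J V \<phi>1 (State C \<theta>) (sem J infer fresh V \<phi>1 (State C \<theta>))"
      "adequate J V \<phi>2 (State C \<theta>) (sem J infer fresh V \<phi>2 (State C \<theta>))"
      using less.prems Or by (auto intro!: less.IH)
    then show ?thesis unfolding Or adequate_def sem.simps sat.simps by blast
  next
    case (And \<phi>1 \<phi>2)
    let ?S = "sem J infer fresh V \<phi>1 (State C \<theta>)"
    have fv: "free_vars \<phi>1 \<subseteq> V" "free_vars \<phi>2 \<subseteq> V" using less.prems(2) And by auto
    have ad1: "adequate J V \<phi>1 (State C \<theta>) ?S"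
      using less.prems fv And by (intro less.IH) auto
    have ad2: "adequate J V \<phi>2 \<tau> (sem J infer fresh V \<phi>2 \<tau>)" if "\<tau> \<in> ?S" "\<tau> \<noteq> Error" for \<tau>
    proof (cases \<tau>)
      case (State D \<eta>)
      then show ?thesis
        using less.prems(1) fv And adequate_valid[OF ad1 that(1)] by (auto intro!: less.IH)
    qed (use that in simp)
    have "adequate J V \<phi> (State C \<theta>) (\<Union>\<tau>\<in>?S. sem J infer fresh V \<phi>2 \<tau>)"
    proof (rule adequateI)
      fix \<rho> assume "\<rho> \<in> (\<Union>\<tau>\<in>?S. sem J infer fresh V \<phi>2 \<tau>)"
      then obtain \<tau> where \<tau>: "\<tau> \<in> ?S" "\<rho> \<in> sem J infer fresh V \<phi>2 \<tau>" by blast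
      show "valid_state \<rho>"
        using \<tau> adequate_valid[OF ad2[OF \<tau>(1)] \<tau>(2)] by (cases "\<tau> = Error") auto
      fix \<beta> assume \<rho>: "\<rho> \<noteq> Error" and \<beta>: "\<beta> \<in> models J \<rho>"
      then have "\<tau> \<noteq> Error" using \<tau>(2) by auto
      note ad2' = ad2[OF \<tau>(1) this]
      obtain \<beta>' where \<beta>': "\<beta>' \<in> models J \<tau>" "\<And>x. x \<in> V \<Longrightarrow> \<beta>' x = \<beta> x"
        using adequate_sound[OF ad2' \<tau>(2) \<rho> \<beta>] by blast
      obtain \<alpha> where \<alpha>: "\<alpha> \<in> models J (State C \<theta>)" "\<And>x. x \<in> V \<Longrightarrow> \<alpha> x = \<beta>' x"
        using adequate_sound[OF ad1 \<tau>(1) \<open>\<tau> \<noteq> Error\<close> \<beta>'(1)] by blast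
      have "sat J \<beta>' \<phi>1"
        using adequate_sat[OF ad1 \<tau>(1) \<open>\<tau> \<noteq> Error\<close> \<beta>'(1)] .
      \<comment> \<open>Evaluating \<open>\<phi>2\<close> may change values outside
        \<open>V\<close>, so \<open>\<phi>1\<close> is known only for \<open>\<beta>'\<close> and
        has to be transferred to \<open>\<beta>\<close>.\<close>
      moreover have "sat J \<beta>' \<phi>1 \<longleftrightarrow> sat J \<beta> \<phi>1" using \<beta>'(2) fv by (intro sat_cong) auto
      moreover have "sat J \<beta> \<phi>2" using adequate_sat[OF ad2' \<tau>(2) \<rho> \<beta>] .
      moreover have "\<forall>x\<in>V. \<alpha> x = \<beta> x" using \<alpha>(2) \<beta>'(2) by simp
      ultimately show "sat J \<beta> \<phi> \<and> (\<exists>\<alpha>\<in>models J (State C \<theta>). \<forall>x\<in>V. \<alpha> x = \<beta> x)"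
        using \<alpha>(1) And by auto
    next
      fix \<alpha> assume \<alpha>: "\<alpha> \<in> models J (State C \<theta>)" "sat J \<alpha> \<phi>"
      obtain \<tau> \<beta> where \<tau>: "\<tau> \<in> ?S" and \<beta>: "\<beta> \<in> models J \<tau>" "\<And>x. x \<in> V \<Longrightarrow> \<beta> x = \<alpha> x"
        using adequate_complete[OF ad1 \<alpha>(1)] \<alpha>(2) And by auto
      have "\<exists>\<rho>\<in>sem J infer fresh V \<phi>2 \<tau>. \<exists>\<gamma>\<in>models J \<rho>. \<forall>x\<in>V. \<gamma> x = \<alpha> x"
      \<comment> \<open>An \<open>Error\<close> from \<open>\<phi>1\<close> passes through
        \<open>\<phi>2\<close>, and \<open>\<alpha>\<close> itself is one of its models.\<close>
      proof (cases "\<tau> = Error")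
        case False
        have "sat J \<beta> \<phi>2 \<longleftrightarrow> sat J \<alpha> \<phi>2" using \<beta>(2) fv by (intro sat_cong) auto
        then have "sat J \<beta> \<phi>2" using \<alpha>(2) And by simp
        then obtain \<rho> \<gamma> where "\<rho> \<in> sem J infer fresh V \<phi>2 \<tau>" "\<gamma> \<in> models J \<rho>"
          "\<And>x. x \<in> V \<Longrightarrow> \<gamma> x = \<beta> x"
          using adequate_complete[OF ad2[OF \<tau> False] \<beta>(1)] by blast
        then show ?thesis using \<beta>(2) by (metis (no_types))
      qed auto
      with \<tau> show "\<exists>\<rho>\<in>\<Union>\<tau>\<in>?S. sem J infer fresh V \<phi>2 \<tau>. \<exists>\<gamma>\<in>models J \<rho>. \<forall>x\<in>V. \<gamma> x = \<alpha> x"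
        by blast
    qed
    then show ?thesis using And by simp
  next
    case (Neg \<psi>)
    let ?S = "sem J infer fresh V \<psi> (State C \<theta>)"
    have ad: "adequate J V \<psi> (State C \<theta>) ?S"
      using less.prems Neg by (intro less.IH) auto
    consider (failed) "cons_plus J ?S = {}"
      | (equiv) \<tau> where "cons_plus J ?S \<noteq> {}" "\<tau> \<in> cons J ?S" "equivalent J \<tau> (State C \<theta>)"
      | (other) "cons_plus J ?S \<noteq> {}" "\<not> (\<exists>\<tau>\<in>cons J ?S. equivalent J \<tau> (State C \<theta>))"
      by blast
    then show ?thesis
    proof cases
      case failed
      \<comment> \<open>When \<open>\<psi>\<close> fails, its negation already holds in all models,
        so leaving the store unchanged loses nothing.\<close>
      then have "models J (State C \<theta>) = {\<beta> \<in> models J (State C \<theta>). sat J \<beta> \<phi>}"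
        using adequate_cons_plus_empty[OF ad] Neg by auto
      with failed show ?thesis using adequate_infer[OF valid] Neg by simp
    next
      case equiv
      have \<tau>: "\<tau> \<in> ?S" "\<tau> \<noteq> Error" using equiv(2) by (auto simp: cons_def consistent_def)
      then obtain D \<eta> where "\<tau> = State D \<eta>" by (cases \<tau>) auto
      \<comment> \<open>All models of \<open>\<tau>\<close> satisfy \<open>\<psi>\<close>. Since
        they are all the models of the initial state, none satisfies the negation and the empty
        result is adequate.\<close>
      then have "models J \<tau> = models J (State C \<theta>)"
        using models_equivalent adequate_valid[OF ad \<tau>(1)] valid equiv(3) by metis
      then have "\<not> sat J \<alpha> \<phi>" if "\<alpha> \<in> models J (State C \<theta>)" for \<alpha>
        using adequate_sat[OF ad \<tau>] Neg that by simp
      moreover have "sem J infer fresh V \<phi> (State C \<theta>) = {}"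
        unfolding Neg sem.simps Let_def using equiv by auto
      ultimately show ?thesis by (simp add: adequate_def)
    next
      case other
      then have "sem J infer fresh V \<phi> (State C \<theta>) = infer (State (C \<union> {\<phi>}) \<theta>)"
        unfolding Neg sem.simps Let_def by auto
      then show ?thesis using adequate_infer_insert[OF valid] by simp
    qed
  next
    case (Ex x \<psi>)
    define u where "u = fresh V (State C \<theta>) (Ex x \<psi>)"
    define \<psi>' where "\<psi>' = subst_fm \<psi> (Var(x := Var u))"
    let ?S = "sem J infer fresh (insert u V) \<psi>' (State C \<theta>)"
    have "u \<notin> V \<union> vars_state (State C \<theta>) \<union> vars_fm (Ex x \<psi>)"
      using fresh_choice less.prems(1) valid unfolding u_def fresh_choice_def valid_state_def by blast
    then have u: "u \<notin> V" "u \<notin> vars_state (State C \<theta>)" "u \<notin> free_vars \<psi>"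
      using free_vars_subset_vars_fm[of \<psi>] by auto
    \<comment> \<open>This translates between witnesses for \<open>x\<close> in
      \<open>\<psi>\<close> and values of the fresh \<open>u\<close> in
      \<open>\<psi>'\<close>.\<close>
    have sat_\<psi>': "sat J (\<beta>(u := d)) \<psi>' \<longleftrightarrow> sat J (\<beta>(x := d)) \<psi>" for \<beta> d
      unfolding \<psi>'_def sat_subst_fm using u(3) by (intro sat_cong) auto
    have "(\<Union>y\<in>free_vars \<psi>. vars_trm ((Var(x := Var u)) y)) \<subseteq> insert u (free_vars (Ex x \<psi>))"
      by (auto split: if_splits)
    then have "free_vars \<psi>' \<subseteq> insert u V"
      using free_vars_subst_fm[of \<psi> "Var(x := Var u)"] less.prems(2) Ex unfolding \<psi>'_def by blast
    then have ad: "adequate J (insert u V) \<psi>' (State C \<theta>) ?S"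
      using less.prems Ex by (intro less.IH) (auto simp: \<psi>'_def)
    note cons_plus_iff = mem_cons_plus_iff[OF ad]
    have "adequate J V \<phi> (State C \<theta>) (\<Union>\<tau>\<in>cons_plus J ?S. infer (drop_var u \<tau>))"
    proof (rule adequateI)
      fix \<rho> assume "\<rho> \<in> (\<Union>\<tau>\<in>cons_plus J ?S. infer (drop_var u \<tau>))"
      then obtain \<tau> where \<tau>: "\<tau> \<in> ?S" "\<rho> \<in> infer (drop_var u \<tau>)"
        using cons_plus_iff by blast
      note valid_\<tau> = adequate_valid[OF ad \<tau>(1)]
      note valid_drop = valid_state_drop_var[OF valid_\<tau>, of u]
      show "valid_state \<rho>" using valid_state_infer[OF valid_drop \<tau>(2)] .
      fix \<beta> assume \<rho>: "\<rho> \<noteq> Error" and \<beta>: "\<beta> \<in> models J \<rho>"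
      have "\<tau> \<noteq> Error"
        using \<tau>(2) \<rho> by fastforce
      then obtain D \<eta> where State: "\<tau> = State D \<eta>" by (cases \<tau>) auto
      have "\<beta> \<in> models J (drop_var u \<tau>)" using models_infer[OF valid_drop \<tau>(2) \<rho>] \<beta> by simp
      \<comment> \<open>The value \<open>d\<close> that undoes the drop is also the witness for
        \<open>Ex x \<psi>\<close> at \<open>\<beta>\<close>; as \<open>u\<close> is outside
        \<open>V\<close>, the update does not affect agreement there.\<close>
      then obtain d where d: "\<beta>(u := d) \<in> models J \<tau>"
        using models_drop_var_upd valid_\<tau> unfolding State by metis
      have "sat J (\<beta>(x := d)) \<psi>"
        using adequate_sat[OF ad \<tau>(1) \<open>\<tau> \<noteq> Error\<close> d] sat_\<psi>' by simp
      moreover obtain \<alpha> where "\<alpha> \<in> models J (State C \<theta>)"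
        "\<And>y. y \<in> insert u V \<Longrightarrow> \<alpha> y = (\<beta>(u := d)) y"
        using adequate_sound[OF ad \<tau>(1) \<open>\<tau> \<noteq> Error\<close> d] by blast
      ultimately show "sat J \<beta> \<phi> \<and> (\<exists>\<alpha>\<in>models J (State C \<theta>). \<forall>x\<in>V. \<alpha> x = \<beta> x)"
        using u(1) Ex by (metis fun_upd_other insertCI sat.simps(6))
    next
      fix \<alpha> assume \<alpha>: "\<alpha> \<in> models J (State C \<theta>)" "sat J \<alpha> \<phi>"
      then obtain d where "sat J (\<alpha>(u := d)) \<psi>'" using sat_\<psi>' Ex by auto
      then obtain \<tau> \<beta> where \<tau>: "\<tau> \<in> ?S" and \<beta>: "\<beta> \<in> models J \<tau>"
        and agree: "\<And>y. y \<in> insert u V \<Longrightarrow> \<beta> y = (\<alpha>(u := d)) y"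
        \<comment> \<open>Completeness is applied to \<open>\<alpha>(u := d)\<close>, where
          \<open>u\<close> stores the witness; it is still a model because \<open>u\<close> is fresh
          for the initial state.\<close>
        using adequate_complete[OF ad models_fresh_upd[OF u(2) \<alpha>(1)]] by blast
      note valid_\<tau> = adequate_valid[OF ad \<tau>]
      have "\<beta> \<in> models J (drop_var u \<tau>)"
        using models_drop_var_superset[OF valid_\<tau>] \<beta> by blast
      then obtain \<rho> where "\<rho> \<in> infer (drop_var u \<tau>)" "\<beta> \<in> models J \<rho>"
        using infer_covers[OF valid_state_drop_var[OF valid_\<tau>]] by blast
      moreover have "\<forall>y\<in>V. \<beta> y = \<alpha> y" using agree u(1) by auto
      moreover have "\<tau> \<in> cons_plus J ?S" using cons_plus_iff \<tau> \<beta> by blast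
      ultimately show "\<exists>\<rho>\<in>\<Union>\<tau>\<in>cons_plus J ?S. infer (drop_var u \<tau>).
          \<exists>\<beta>\<in>models J \<rho>. \<forall>x\<in>V. \<beta> x = \<alpha> x"
        by blast
    qed
    then show ?thesis using Ex by (simp add: Let_def u_def \<psi>'_def)
  qed
qed

end

theorem theorem1:
  fixes J :: "('f, 'p, 'a) struct"
    and infer :: "('f, 'p, 'v :: infinite) inference"
    and fresh :: "('f, 'p, 'v) choice"
    and C :: "('f, 'p, 'v) fm set"
    and \<theta> :: "('f, 'v) subst"
    and \<phi> :: "('f, 'p, 'v) fm"
  assumes "infer_conditions J infer"
    and "infer_preserves_idempotency infer"
    and "fresh_choice fresh"
    and "is_state (State C \<theta>)"
    and "idempotent \<theta>"
  shows "(\<forall>C' \<theta>'. State C' \<theta>' \<in> denotation J infer fresh \<phi> (State C \<theta>) \<longrightarrow>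
            entails J (State C' \<theta>') \<phi>) \<and>
         (cons_plus J (denotation J infer fresh \<phi> (State C \<theta>)) = {} \<longrightarrow>
            entails J (State C \<theta>) (Neg \<phi>))"
proof -
  interpret inference_semantics J infer fresh
    using assms(1-3) by unfold_locales
  have ad: "adequate J (vars_fm \<phi>) \<phi> (State C \<theta>) (denotation J infer fresh \<phi> (State C \<theta>))"
    unfolding denotation_def using assms(4,5)
    by (intro sem_adequate) (simp_all add: valid_state_def free_vars_subset_vars_fm)
  have "entails J (State C' \<theta>') \<phi>"
    if "State C' \<theta>' \<in> denotation J infer fresh \<phi> (State C \<theta>)" for C' \<theta>'
  proof -
    \<comment> \<open>Passing from models back to entailment requires idempotence of the computed
      substitution, which adequacy includes.\<close>
    have "idempotent \<theta>'" using adequate_valid[OF ad that] by (simp add: valid_state_def)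
    then show ?thesis
      using entails_iff_models adequate_sat[OF ad that] by blast
  qed
  moreover have "entails J (State C \<theta>) (Neg \<phi>)"
    if "cons_plus J (denotation J infer fresh \<phi> (State C \<theta>)) = {}"
    using adequate_cons_plus_empty[OF ad that] entails_iff_models[OF assms(5)]
    by (metis sat.simps(5))
  ultimately show ?thesis by blast
qed

end
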